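(* Let $p\in\mathbb{R}[x_1,\dots,x_n]$ be a $d$-homogeneous polynomial with nonnegative coefficients such that: (1) for any $0\leqslant k\leqslant d-2$ and any $(i_1,\dots,i_k)\in[n]^k$, $\partial_{i_1}\cdots\partial_{i_k}p$ is indecomposable, and (2) for any $(i_1,\dots,i_{d-2})\in[n]^{d-2}$, the quadratic $\partial_{i_1}\cdots\partial_{i_{d-2}}p$ is either identically zero or log-concave at $\mathbb{1}$. Then $p$ is strongly log-concave at $\mathbb{1}$.
   Context: A polynomial $q$ with nonnegative coefficients is log-concave at $\mathbb{1}=(1,\dots,1)$ if it is identically zero or the Hessian of $\log q$ at $\mathbb{1}$ is negative semidefinite; it is strongly log-concave at $\mathbb{1}$ if for every $m\geqslant0$ and all $1\leqslant i_1,\dots,i_m\leqslant n$ (repetitions allowed), $\partial_{i_1}\cdots\partial_{i_m}q$ is log-concave at $\mathbb{1}$. A polynomial $q$ is decomposable if there exist a nonempty $I\subsetneq[n]$ and nonzero polynomials $g\in\mathbb{R}[x_i:i\in I]$, $h\in\mathbb{R}[x_i:i\notin I]$ with $q=g+h$; otherwise it is indecomposable. *)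

theory Defs
  imports "HOL-Analysis.Analysis" "HOL-Library.Poly_Mapping"
begin

text \<open>Polynomials in the variables \<open>x\<^sub>i\<close>, \<open>i :: 'n\<close>, are finitely supported maps from exponent
  vectors to coefficients; the number of variables is \<open>CARD('n)\<close>.\<close>

type_synonym 'n mpoly = "('n \<Rightarrow>\<^sub>0 nat) \<Rightarrow>\<^sub>0 real"

definition mpoly_eval :: "'n::finite mpoly \<Rightarrow> real ^ 'n \<Rightarrow> real" where
  "mpoly_eval p x =
     (\<Sum>m\<in>Poly_Mapping.keys p. Poly_Mapping.lookup p m * (\<Prod>i\<in>UNIV. (x $ i) ^ Poly_Mapping.lookup m i))"

text \<open>The exponent subtraction below truncates only where the coefficient vanishes.\<close>

definition mpoly_pderiv :: "'n \<Rightarrow> 'n mpoly \<Rightarrow> 'n mpoly" where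
  "mpoly_pderiv i p =
     (\<Sum>m\<in>Poly_Mapping.keys p.
        Poly_Mapping.single (m - Poly_Mapping.single i 1)
          (real (Poly_Mapping.lookup m i) * Poly_Mapping.lookup p m))"

definition mpoly_pderivs :: "'n list \<Rightarrow> 'n mpoly \<Rightarrow> 'n mpoly" where
  "mpoly_pderivs is p = foldr mpoly_pderiv is p"

definition nonneg_coeffs :: "'n mpoly \<Rightarrow> bool" where
  "nonneg_coeffs p \<longleftrightarrow> (\<forall>m. 0 \<le> Poly_Mapping.lookup p m)"

definition homogeneous :: "nat \<Rightarrow> 'n::finite mpoly \<Rightarrow> bool" where
  "homogeneous d p \<longleftrightarrow> (\<forall>m\<in>Poly_Mapping.keys p. (\<Sum>i\<in>UNIV. Poly_Mapping.lookup m i) = d)"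

definition mpolys_over :: "'n set \<Rightarrow> 'n mpoly set" where
  "mpolys_over I = {p. \<forall>m\<in>Poly_Mapping.keys p. Poly_Mapping.keys m \<subseteq> I}"

definition nonconstant :: "'n mpoly \<Rightarrow> bool" where
  "nonconstant p \<longleftrightarrow> (\<exists>m\<in>Poly_Mapping.keys p. m \<noteq> 0)"

text \<open>The summands of a decomposition have to be nonzero, where constants count as zero: a constant
  is a polynomial in every set of variables, so if constant summands were admitted then
  \<open>0 = 1 + (-1)\<close> and \<open>x\<^sub>1x\<^sub>2 = (x\<^sub>1x\<^sub>2 - 1) + 1\<close> (in three variables) would be decomposable, and
  indecomposability of all partial derivatives would fail for every multiaffine form of degree at
  least 3. For a homogeneous polynomial of positive degree the condition below says that it is a
  sum of two nonzero homogeneous polynomials of that degree in disjoint sets of variables.\<close>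

definition decomposable :: "'n mpoly \<Rightarrow> bool" where
  "decomposable q \<longleftrightarrow>
     (\<exists>I g h. I \<noteq> {} \<and> I \<subset> UNIV \<and> g \<in> mpolys_over I \<and> h \<in> mpolys_over (- I) \<and>
        nonconstant g \<and> nonconstant h \<and> q = g + h)"

abbreviation indecomposable :: "'n mpoly \<Rightarrow> bool" where
  "indecomposable q \<equiv> \<not> decomposable q"

text \<open>Indecomposability in the sense that admits constant summands is the stronger condition.\<close>

lemma indecomposable_if_no_nonzero_summands:
  assumes "\<not> (\<exists>I g h. I \<noteq> {} \<and> I \<subset> UNIV \<and> g \<in> mpolys_over I \<and> h \<in> mpolys_over (- I) \<and>
                 g \<noteq> 0 \<and> h \<noteq> 0 \<and> q = g + h)"
  shows "indecomposable q"
proof -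
  have nz: "g \<noteq> 0" if "nonconstant g" for g :: "'a mpoly"
    using that by (auto simp: nonconstant_def)
  show ?thesis
    using assms unfolding decomposable_def by (blast dest: nz)
qed

definition partial_deriv :: "'n::finite \<Rightarrow> (real ^ 'n \<Rightarrow> real) \<Rightarrow> real ^ 'n \<Rightarrow> real" where
  "partial_deriv i f x = deriv (\<lambda>t. f (x + t *\<^sub>R axis i 1)) 0"

definition hessian :: "(real ^ 'n::finite \<Rightarrow> real) \<Rightarrow> real ^ 'n \<Rightarrow> real ^ 'n ^ 'n" where
  "hessian f x = (\<chi> i j. partial_deriv i (partial_deriv j f) x)"

definition negative_semidefinite :: "real ^ 'n ^ 'n::finite \<Rightarrow> bool" where
  "negative_semidefinite A \<longleftrightarrow> transpose A = A \<and> (\<forall>v. v \<bullet> (A *v v) \<le> 0)"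

definition log_concave_at_one :: "'n::finite mpoly \<Rightarrow> bool" where
  "log_concave_at_one q \<longleftrightarrow>
     q = 0 \<or> negative_semidefinite (hessian (\<lambda>x. ln (mpoly_eval q x)) (\<chi> i. 1))"

definition strongly_log_concave_at_one :: "'n::finite mpoly \<Rightarrow> bool" where
  "strongly_log_concave_at_one q \<longleftrightarrow> (\<forall>is. log_concave_at_one (mpoly_pderivs is q))"

end

theory Submission
  imports Defs
begin

text \<open>
  By induction on the degree it suffices to pass from the partial derivatives \<open>\<partial>\<^sub>i p\<close> to an
  indecomposable \<open>p\<close> of degree \<open>d \<ge> 3\<close>. Let \<open>H\<close> and \<open>H\<^sub>i\<close> be the Hessians of \<open>p\<close> and
  \<open>\<partial>\<^sub>i p\<close> at the all-ones vector and \<open>D\<close> the diagonal matrix of row sums of \<open>H\<close>. By Euler's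
  identity \<open>(d - 2) H\<close> is the sum of the \<open>H\<^sub>i\<close>, and log-concavity of \<open>\<partial>\<^sub>i p\<close> says that the
  quadratic form of \<open>H\<^sub>i\<close> at \<open>v\<close> is at most \<open>(d - 2) (H v)\<^sub>i\<^sup>2 / D\<^sub>i\<close>. Summing,
  \<open>v\<^sup>T H v \<le> v\<^sup>T H D\<^sup>-\<^sup>1 H v\<close>, so every eigenvalue \<open>l\<close> of the stochastic matrix \<open>D\<^sup>-\<^sup>1 H\<close>
  satisfies \<open>l \<le> l\<^sup>2\<close>: a positive eigenvalue is at least, hence equal to, 1. Indecomposability
  makes the eigenvalue 1 simple, so \<open>H\<close> is nonpositive on the vectors \<open>D\<close>-orthogonal to the
  all-ones vector, which is equivalent to log-concavity of \<open>p\<close>.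

  Only one eigenvector is needed, and it is obtained by maximizing the form of \<open>H\<close> on the
  \<open>D\<close>-unit sphere inside that hyperplane.
\<close>

section \<open>Symmetric matrices with nonnegative entries\<close>

text \<open>Near 0 the linear term dominates, so a nonzero \<open>b\<close> would make the quadratic
  positive at a small argument of the same sign as \<open>b\<close>.\<close>

lemma linear_coeff_zero_if_quadratic_nonpos:
  fixes a b :: real
  assumes "\<And>t. a * t\<^sup>2 + b * t \<le> 0"
  shows "b = 0"
proof (rule ccontr)
  assume b: "b \<noteq> 0"
  \<comment> \<open>This choice makes the value at \<open>b / s\<close> equal to
    \<open>(a + s) * (b / s)\<^sup>2\<close> with \<open>a + s\<close> at least 1.\<close>
  define s where "s = \<bar>a\<bar> + 1"
  have s: "s > 0" "a + s \<ge> 1"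
    by (auto simp: s_def)
  have "a * (b / s)\<^sup>2 + b * (b / s) = (a + s) * (b / s)\<^sup>2"
    using s(1) by (simp add: field_simps power2_eq_square)
  moreover have "(a + s) * (b / s)\<^sup>2 > 0"
    using s b by (intro mult_pos_pos) auto
  ultimately show False
    using assms[of "b / s"] by linarith
qed

lemma inner_matrix_vector_sum:
  fixes M :: "real ^ 'n ^ 'n"
  shows "u \<bullet> (M *v v) = (\<Sum>i\<in>UNIV. \<Sum>j\<in>UNIV. M $ i $ j * u $ i * v $ j)"
  by (simp add: inner_vec_def matrix_vector_mult_def sum_distrib_left mult_ac)

lemma inner_matrix_vector_symmetric:
  fixes M :: "real ^ 'n ^ 'n"
  assumes "transpose M = M"
  shows "u \<bullet> (M *v v) = v \<bullet> (M *v u)"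
  by (metis assms dot_lmul_matrix inner_commute transpose_matrix_vector)

text \<open>A Lagrange condition without calculus: the form of \<open>H - l E\<close> is nonpositive
  on \<open>W\<close> and vanishes at \<open>v\<close>, so along the line \<open>v + t u\<close> its
  linear coefficient in \<open>t\<close> is zero.\<close>

lemma maximizer_stationary:
  fixes H E :: "real ^ 'n ^ 'n"
  assumes "transpose H = H" "transpose E = E" "subspace W" "v \<in> W" "u \<in> W"
    and max: "\<And>w. w \<in> W \<Longrightarrow> w \<bullet> (H *v w) \<le> l * (w \<bullet> (E *v w))"
    and eq: "v \<bullet> (H *v v) = l * (v \<bullet> (E *v v))"
  shows "u \<bullet> (H *v v) = l * (u \<bullet> (E *v v))"
proof -
  have "(u \<bullet> (H *v u) - l * (u \<bullet> (E *v u))) * t\<^sup>2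
      + (2 * (u \<bullet> (H *v v)) - 2 * l * (u \<bullet> (E *v v))) * t \<le> 0" for t
  proof -
    have "v + t *\<^sub>R u \<in> W"
      using assms by (simp add: subspace_add subspace_scale)
    from max[OF this] show ?thesis
      using eq inner_matrix_vector_symmetric[OF assms(1), of v u]
        inner_matrix_vector_symmetric[OF assms(2), of v u]
      by (simp add: matrix_vector_right_distrib matrix_vector_mult_scaleR inner_add_left
          inner_add_right algebra_simps power2_eq_square)
  qed
  from linear_coeff_zero_if_quadratic_nonpos[OF this] show ?thesis
    by simp
qed

text \<open>This is twice the form of the weighted graph Laplacian \<open>D - H\<close>; for
  nonnegative entries it can vanish only if \<open>v\<close> is constant along edges, that is, along
  nonzero entries of \<open>H\<close>.\<close>

lemma quadratic_form_row_sums: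
  fixes H :: "real ^ 'n ^ 'n"
  assumes "transpose H = H" and D: "\<And>i. D i = (\<Sum>j\<in>UNIV. H $ i $ j)"
  shows "(\<Sum>i\<in>UNIV. \<Sum>j\<in>UNIV. H $ i $ j * (v $ i - v $ j)\<^sup>2)
       = 2 * (\<Sum>i\<in>UNIV. D i * (v $ i)\<^sup>2) - 2 * (v \<bullet> (H *v v))"
proof -
  have sym: "H $ i $ j = H $ j $ i" for i j
    using assms(1) by (metis transpose_def vec_lambda_beta)
  have 1: "(\<Sum>i\<in>UNIV. \<Sum>j\<in>UNIV. H $ i $ j * (v $ i)\<^sup>2) = (\<Sum>i\<in>UNIV. D i * (v $ i)\<^sup>2)"
    by (simp add: D sum_distrib_right)
  have 2: "(\<Sum>i\<in>UNIV. \<Sum>j\<in>UNIV. H $ i $ j * (v $ j)\<^sup>2) = (\<Sum>i\<in>UNIV. D i * (v $ i)\<^sup>2)"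
    by (subst sum.swap) (simp add: D sum_distrib_right sym)
  have "(\<Sum>i\<in>UNIV. \<Sum>j\<in>UNIV. H $ i $ j * (v $ i - v $ j)\<^sup>2)
      = (\<Sum>i\<in>UNIV. \<Sum>j\<in>UNIV. H $ i $ j * (v $ i)\<^sup>2 + H $ i $ j * (v $ j)\<^sup>2
           - 2 * (H $ i $ j * v $ i * v $ j))"
    by (intro sum.cong refl) (simp add: algebra_simps power2_eq_square)
  also have "\<dots> = 2 * (\<Sum>i\<in>UNIV. D i * (v $ i)\<^sup>2) - 2 * (v \<bullet> (H *v v))"
    by (simp add: sum.distrib sum_subtractf 1 2 inner_matrix_vector_sum flip: sum_distrib_left)
  finally show ?thesis .
qed

lemma compact_weighted_sphere:
  fixes E :: "'n::finite \<Rightarrow> real"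
  assumes "\<And>i. E i > 0"
  shows "compact {v :: real ^ 'n. (\<Sum>i\<in>UNIV. E i * (v $ i)\<^sup>2) = 1}"
proof -
  have "norm v \<le> (\<Sum>i\<in>UNIV. 1 + 1 / E i)" if v: "(\<Sum>i\<in>UNIV. E i * (v $ i)\<^sup>2) = 1" for v :: "real ^ 'n"
  proof -
    have "\<bar>v $ i\<bar> \<le> 1 + 1 / E i" for i
    proof -
      have "E i * (v $ i)\<^sup>2 \<le> 1"
        using member_le_sum[of i UNIV "\<lambda>i. E i * (v $ i)\<^sup>2"] v assms
        by (simp add: less_imp_le)
      then have "(v $ i)\<^sup>2 \<le> 1 / E i"
        using assms[of i] by (simp add: field_simps)
      \<comment> \<open>Expanding the square of \<open>\<bar>v $ i\<bar> - 1\<close> bounds the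
        absolute value without square roots.\<close>
      moreover have "\<bar>v $ i\<bar> \<le> 1 + (v $ i)\<^sup>2"
        using zero_le_power2[of "\<bar>v $ i\<bar> - 1"] zero_le_power2[of "v $ i"]
        by (simp add: power2_diff)
      ultimately show ?thesis
        by linarith
    qed
    then show ?thesis
      by (intro order.trans[OF norm_le_l1_cart] sum_mono)
  qed
  then have "bounded {v :: real ^ 'n. (\<Sum>i\<in>UNIV. E i * (v $ i)\<^sup>2) = 1}"
    by (auto simp: bounded_iff)
  moreover have "closed {v :: real ^ 'n. (\<Sum>i\<in>UNIV. E i * (v $ i)\<^sup>2) = 1}"
    by (intro closed_Collect_eq continuous_intros)
  ultimately show ?thesis
    by (simp add: compact_eq_bounded_closed)
qed

text \<open>A positive value on the hyperplane yields an eigenvector \<open>v\<close> there with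
  eigenvalue \<open>l > 0\<close>. Then \<open>trickle\<close> forces \<open>l \<ge> 1\<close>, the
  Laplacian identity makes \<open>v\<close> constant along edges, \<open>connected\<close> makes it
  constant where \<open>D\<close> is nonzero, and the hyperplane equation makes that constant
  zero.\<close>

lemma nonpos_on_hyperplane_if_trickle_down:
  fixes H :: "real ^ 'n ^ 'n"
  assumes sym: "transpose H = H" and nonneg: "\<And>i j. 0 \<le> H $ i $ j"
    and D: "\<And>i. D i = (\<Sum>j\<in>UNIV. H $ i $ j)"
    and trickle: "\<And>v. v \<bullet> (H *v v) \<le> (\<Sum>i\<in>UNIV. ((H *v v) $ i)\<^sup>2 / D i)"
    and connected: "\<And>I i j. \<lbrakk>i \<in> I; j \<notin> I; D i \<noteq> 0; D j \<noteq> 0\<rbrakk>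
                      \<Longrightarrow> \<exists>k l. k \<in> I \<and> l \<notin> I \<and> H $ k $ l \<noteq> 0"
    and w: "(\<Sum>i\<in>UNIV. D i * w $ i) = 0"
  shows "w \<bullet> (H *v w) \<le> 0"
proof (rule ccontr)
  assume "\<not> w \<bullet> (H *v w) \<le> 0"
  then have pos: "w \<bullet> (H *v w) > 0"
    by simp
  \<comment> \<open>Variables that do not occur get weight 1, so that the unit sphere is compact.\<close>
  define d where "d i = (if D i = 0 then 1 else D i)" for i
  define E :: "real ^ 'n ^ 'n" where "E = (\<chi> i j. if i = j then d i else 0)"
  define W where "W = {v :: real ^ 'n. (\<Sum>i\<in>UNIV. D i * v $ i) = 0}"
  have D_nonneg: "D i \<ge> 0" for i
    by (simp add: D nonneg sum_nonneg)
  have d_pos: "d i > 0" and D_le_d: "D i \<le> d i" for i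
    using D_nonneg[of i] by (auto simp: d_def)
  have symE: "transpose E = E"
    by (auto simp: E_def transpose_def vec_eq_iff)
  have Ev: "(E *v v) $ i = d i * v $ i" for v i
    by (simp add: E_def matrix_vector_mult_def if_distrib[of "\<lambda>x. x * _"] cong: if_cong)
  have uEv: "u \<bullet> (E *v v) = (\<Sum>i\<in>UNIV. d i * (u $ i * v $ i))" for u v
    by (simp add: inner_vec_def Ev mult_ac)
  have vEv: "v \<bullet> (E *v v) = (\<Sum>i\<in>UNIV. d i * (v $ i)\<^sup>2)" for v
    by (simp add: uEv power2_eq_square)
  have Epos: "v \<bullet> (E *v v) > 0" if v0: "v \<noteq> 0" for v
  proof -
    obtain i where "v $ i \<noteq> 0"
      using v0 by (auto simp: vec_eq_iff)
    then have "0 < d i * (v $ i)\<^sup>2"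
      using d_pos by simp
    then show ?thesis
      unfolding vEv by (intro sum_pos2[of _ i]) (auto simp: d_pos less_imp_le)
  qed
  have W: "subspace W"
    unfolding W_def subspace_def
    by (auto simp: algebra_simps sum.distrib simp flip: sum_distrib_left)
  define K where "K = {v. (\<Sum>i\<in>UNIV. d i * (v $ i)\<^sup>2) = 1} \<inter> W"
  have "closed W"
    unfolding W_def by (intro closed_Collect_eq continuous_intros)
  then have K: "compact K"
    unfolding K_def by (intro compact_Int_closed compact_weighted_sphere d_pos)
  \<comment> \<open>Rescaling to the \<open>E\<close>-unit sphere turns the maximum over
    \<open>K\<close> into a bound for the Rayleigh quotient on all of \<open>W\<close>.\<close>
  define nz where "nz v = (1 / sqrt (v \<bullet> (E *v v))) *\<^sub>R v" for v :: "real ^ 'n"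
  have nz_K: "nz v \<in> K" if "v \<in> W" "v \<noteq> 0" for v
    using Epos[OF that(2)] that(1) W
    by (auto simp: K_def nz_def subspace_scale simp flip: vEv)
       (simp add: matrix_vector_mult_scaleR real_div_sqrt)
  have nz_H: "nz v \<bullet> (H *v nz v) = (v \<bullet> (H *v v)) / (v \<bullet> (E *v v))" if "v \<noteq> 0" for v
    using Epos[OF that] by (simp add: nz_def matrix_vector_mult_scaleR flip: power2_eq_square)
  have w0: "w \<noteq> 0" and wW: "w \<in> W"
    using pos w by (auto simp: W_def)
  have "continuous_on K (\<lambda>v. v \<bullet> (H *v v))"
    unfolding inner_matrix_vector_sum by (intro continuous_intros)
  with K nz_K[OF wW w0] obtain v where vK: "v \<in> K"
    and vmax: "\<And>u. u \<in> K \<Longrightarrow> u \<bullet> (H *v u) \<le> v \<bullet> (H *v v)"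
    using continuous_attains_sup[of K "\<lambda>v. v \<bullet> (H *v v)"] by blast
  define l where "l = v \<bullet> (H *v v)"
  have vW: "v \<in> W" and v1: "v \<bullet> (E *v v) = 1"
    using vK by (auto simp: K_def vEv)
  have "nz w \<bullet> (H *v nz w) > 0"
    using pos Epos[OF w0] by (simp add: nz_H w0)
  then have l_pos: "l > 0"
    using vmax[OF nz_K[OF wW w0]] by (simp add: l_def)
  have max: "u \<bullet> (H *v u) \<le> l * (u \<bullet> (E *v u))" if "u \<in> W" for u
  proof (cases "u = 0")
    case False
    then show ?thesis
      using vmax[OF nz_K[OF that False]] Epos[OF False]
      by (simp add: nz_H l_def field_simps)
  qed simp
  have H0: "H $ i $ j = 0" if "D i = 0" for i j
    using that nonneg sum_nonneg_eq_0_iff[of UNIV "\<lambda>j. H $ i $ j"] by (simp add: D)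
  have symH: "H $ i $ j = H $ j $ i" for i j
    using sym by (metis transpose_def vec_lambda_beta)
  have sum_Hv: "(\<Sum>i\<in>UNIV. (H *v u) $ i) = (\<Sum>i\<in>UNIV. D i * u $ i)" for u
    unfolding matrix_vector_mult_def
    by simp (subst sum.swap, simp add: D sum_distrib_right symH)
  \<comment> \<open>The residual of the eigenvector equation is itself an admissible direction.\<close>
  define u where "u = (\<chi> i. (H *v v) $ i / d i - l * v $ i)"
  \<comment> \<open>If \<open>D i = 0\<close>, row \<open>i\<close> of \<open>H\<close> is zero and
    both sides vanish; otherwise \<open>d i = D i\<close>. Summed over \<open>i\<close>, the right
    side is zero because \<open>v\<close> lies in \<open>W\<close> and the column sums of
    \<open>H\<close> are also \<open>D\<close>.\<close>
  have "D i * u $ i = (H *v v) $ i - l * (D i * v $ i)" for i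
    using d_pos[of i] H0[of i]
    by (auto simp: u_def d_def field_simps matrix_vector_mult_def)
  then have "u \<in> W"
    using vW by (simp add: W_def sum_subtractf sum_Hv flip: sum_distrib_left)
  then have "u \<bullet> (H *v v) = l * (u \<bullet> (E *v v))"
    by (rule maximizer_stationary[OF sym symE W vW _ max]) (auto simp: l_def v1)
  \<comment> \<open>The residual equals \<open>E *v u\<close>, so stationarity in direction
    \<open>u\<close> says that the form of \<open>E\<close> vanishes at \<open>u\<close>; positive
    definiteness gives \<open>u = 0\<close>.\<close>
  then have "u \<bullet> (H *v v - l *\<^sub>R (E *v v)) = 0"
    by (simp add: inner_diff_right)
  moreover have "H *v v - l *\<^sub>R (E *v v) = E *v u"
    using d_pos by (auto simp: vec_eq_iff Ev u_def field_simps less_imp_neq[symmetric])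
  ultimately have "u = 0"
    using Epos[of u] by (cases "u = 0") auto
  then have eig: "(H *v v) $ i = l * d i * v $ i" for i
    using d_pos[of i] by (auto simp: vec_eq_iff u_def field_simps dest!: spec[of _ i])
  have Dd: "(\<Sum>i\<in>UNIV. D i * (v $ i)\<^sup>2) \<le> 1"
    unfolding v1[symmetric] vEv by (intro sum_mono mult_right_mono D_le_d) auto
  have "l \<le> (\<Sum>i\<in>UNIV. ((H *v v) $ i)\<^sup>2 / D i)"
    using trickle[of v] by (simp add: l_def)
  \<comment> \<open>At \<open>D i = 0\<close> division by zero yields 0, which agrees with the right
    side.\<close>
  also have "\<dots> = (\<Sum>i\<in>UNIV. l\<^sup>2 * (D i * (v $ i)\<^sup>2))"
    by (intro sum.cong refl) (auto simp: eig d_def power2_eq_square)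
  also have "\<dots> = l\<^sup>2 * (\<Sum>i\<in>UNIV. D i * (v $ i)\<^sup>2)"
    by (simp add: sum_distrib_left)
  also have "\<dots> \<le> l\<^sup>2 * 1"
    using Dd by (intro mult_left_mono) auto
  finally have l1: "l \<ge> 1"
    using l_pos by (simp add: power2_eq_square)
  \<comment> \<open>The Laplacian form is the \<open>D\<close>-weighted square norm, at most 1,
    minus \<open>l\<close>, at least 1.\<close>
  have "(\<Sum>i\<in>UNIV. \<Sum>j\<in>UNIV. H $ i $ j * (v $ i - v $ j)\<^sup>2) \<le> 0"
    using quadratic_form_row_sums[OF sym D, of v] l1 Dd by (simp add: l_def)
  then have "(\<Sum>i\<in>UNIV. \<Sum>j\<in>UNIV. H $ i $ j * (v $ i - v $ j)\<^sup>2) = 0"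
    by (intro antisym sum_nonneg) (auto simp: nonneg)
  then have edge: "v $ i = v $ j" if "H $ i $ j \<noteq> 0" for i j
    using that by (auto simp: sum_nonneg_eq_0_iff sum_nonneg nonneg)
  have off: "v $ i = 0" if "D i = 0" for i
    using eig[of i] H0[OF that] l_pos d_pos[of i] by (auto simp: matrix_vector_mult_def)
  have "v \<noteq> 0"
    using v1 by auto
  then obtain i where i: "v $ i \<noteq> 0"
    by (metis vec_eq_iff zero_index)
  \<comment> \<open>No edge leaves the level set of \<open>v\<close> through \<open>i\<close>, so it
    contains every index of nonzero weight; the factor \<open>D j\<close> absorbs the
    others.\<close>
  have const: "D j * v $ j = D j * v $ i" for j
    using connected[of i "{k. v $ k = v $ i}" j] edge off i by fastforce
  have "(\<Sum>j\<in>UNIV. D j) * v $ i = 0"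
    using vW by (simp add: W_def const sum_distrib_right)
  then have "D i = 0"
    using i D_nonneg by (simp add: sum_nonneg_eq_0_iff)
  then show False
    using off i by blast
qed

section \<open>Polynomials and their partial derivatives\<close>

text \<open>Truncated subtraction may also send an exponent without the variable \<open>i\<close> to
  \<open>m\<close>, but such a term carries the factor 0, so a single exponent contributes.\<close>

lemma lookup_mpoly_pderiv:
  "Poly_Mapping.lookup (mpoly_pderiv i p) m
     = real (Poly_Mapping.lookup m i + 1) * Poly_Mapping.lookup p (m + Poly_Mapping.single i 1)"
proof -
  let ?e = "Poly_Mapping.single i (1::nat)"
  have key: "(k - ?e = m \<and> Poly_Mapping.lookup k i \<noteq> 0) \<longleftrightarrow> k = m + ?e" for k
  proof
    assume "k - ?e = m \<and> Poly_Mapping.lookup k i \<noteq> 0"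
    then show "k = m + ?e"
      by (intro poly_mapping_eqI) (auto simp: lookup_add lookup_minus lookup_single when_def)
  qed (auto simp: lookup_add)
  have "Poly_Mapping.lookup (mpoly_pderiv i p) m
      = (\<Sum>k\<in>Poly_Mapping.keys p. if k = m + ?e
           then real (Poly_Mapping.lookup k i) * Poly_Mapping.lookup p k else 0)"
    unfolding mpoly_pderiv_def lookup_sum
  proof (intro sum.cong refl)
    fix k
    show "Poly_Mapping.lookup (Poly_Mapping.single (k - ?e)
            (real (Poly_Mapping.lookup k i) * Poly_Mapping.lookup p k)) m
        = (if k = m + ?e then real (Poly_Mapping.lookup k i) * Poly_Mapping.lookup p k else 0)"
      using key[of k] by (auto simp: lookup_single when_def)
  qed
  then show ?thesis
    by (auto simp: lookup_add in_keys_iff)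
qed

lemma mpoly_pderiv_commute: "mpoly_pderiv i (mpoly_pderiv j p) = mpoly_pderiv j (mpoly_pderiv i p)"
  by (intro poly_mapping_eqI)
     (auto simp: lookup_mpoly_pderiv lookup_add lookup_single add_ac when_def)

lemma mpoly_pderiv_0 [simp]: "mpoly_pderiv i 0 = 0"
  by (simp add: mpoly_pderiv_def)

lemma mpoly_pderivs_Nil [simp]: "mpoly_pderivs [] p = p"
  by (simp add: mpoly_pderivs_def)

lemma mpoly_pderivs_Cons [simp]: "mpoly_pderivs (i # is) p = mpoly_pderiv i (mpoly_pderivs is p)"
  by (simp add: mpoly_pderivs_def)

lemma mpoly_pderivs_append: "mpoly_pderivs (is @ js) p = mpoly_pderivs is (mpoly_pderivs js p)"
  by (simp add: mpoly_pderivs_def)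

lemma nonneg_coeffs_pderiv: "nonneg_coeffs p \<Longrightarrow> nonneg_coeffs (mpoly_pderiv i p)"
  by (simp add: nonneg_coeffs_def lookup_mpoly_pderiv)

lemma nonneg_coeffs_pderivs: "nonneg_coeffs p \<Longrightarrow> nonneg_coeffs (mpoly_pderivs is p)"
  by (induction "is") (auto intro: nonneg_coeffs_pderiv)

lemma homogeneous_pderiv:
  assumes "homogeneous d p"
  shows "homogeneous (d - 1) (mpoly_pderiv i p)"
  unfolding homogeneous_def
proof
  fix m assume "m \<in> Poly_Mapping.keys (mpoly_pderiv i p)"
  then have "m + Poly_Mapping.single i 1 \<in> Poly_Mapping.keys p"
    by (auto simp: in_keys_iff lookup_mpoly_pderiv)
  then have "(\<Sum>j\<in>UNIV. Poly_Mapping.lookup (m + Poly_Mapping.single i 1) j) = d"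
    using assms by (auto simp: homogeneous_def)
  then show "(\<Sum>j\<in>UNIV. Poly_Mapping.lookup m j) = d - 1"
    by (auto simp: lookup_add lookup_single sum.distrib when_def)
qed

text \<open>Truncation of the degree is harmless: past degree 0 the derivative is zero, and zero is
  homogeneous of every degree.\<close>

lemma homogeneous_pderivs:
  "homogeneous d p \<Longrightarrow> homogeneous (d - length is) (mpoly_pderivs is p)"
proof (induction "is")
  case (Cons i "is")
  then show ?case
    using homogeneous_pderiv[of "d - length is" "mpoly_pderivs is p" i] by simp
qed simp

lemma mpoly_pderiv_homogeneous_0:
  assumes "homogeneous 0 p"
  shows "mpoly_pderiv i p = 0"
proof (intro poly_mapping_eqI, rule ccontr)
  fix m assume "Poly_Mapping.lookup (mpoly_pderiv i p) m \<noteq> Poly_Mapping.lookup 0 m"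
  then have "m + Poly_Mapping.single i 1 \<in> Poly_Mapping.keys p"
    by (auto simp: in_keys_iff lookup_mpoly_pderiv)
  then have "Poly_Mapping.lookup (m + Poly_Mapping.single i 1) i = 0"
    using assms by (auto simp: homogeneous_def)
  then show False
    by (simp add: lookup_add)
qed

section \<open>Evaluation and its directional derivatives\<close>

definition monom_eval :: "('n::finite \<Rightarrow>\<^sub>0 nat) \<Rightarrow> real ^ 'n \<Rightarrow> real" where
  "monom_eval m x = (\<Prod>i\<in>UNIV. (x $ i) ^ Poly_Mapping.lookup m i)"

lemma mpoly_eval_superset:
  assumes "finite A" "Poly_Mapping.keys p \<subseteq> A"
  shows "mpoly_eval p x = (\<Sum>m\<in>A. Poly_Mapping.lookup p m * monom_eval m x)"
  unfolding mpoly_eval_def monom_eval_def[symmetric]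
  using assms by (intro sum.mono_neutral_left) (auto simp: in_keys_iff)

lemma mpoly_eval_0 [simp]: "mpoly_eval 0 x = 0"
  by (simp add: mpoly_eval_def)

lemma mpoly_eval_add: "mpoly_eval (p + q) x = mpoly_eval p x + mpoly_eval q x"
proof -
  let ?A = "Poly_Mapping.keys p \<union> Poly_Mapping.keys q"
  have "Poly_Mapping.keys (p + q) \<subseteq> ?A"
    by (rule Poly_Mapping.keys_add)
  then show ?thesis
    by (simp add: mpoly_eval_superset[of ?A] lookup_add algebra_simps sum.distrib)
qed

lemma mpoly_eval_sum: "mpoly_eval (\<Sum>a\<in>A. f a) x = (\<Sum>a\<in>A. mpoly_eval (f a) x)"
  by (induction A rule: infinite_finite_induct) (auto simp: mpoly_eval_add)

lemma mpoly_eval_single: "mpoly_eval (Poly_Mapping.single m c) x = c * monom_eval m x"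
  by (simp add: mpoly_eval_superset[of "{m}"])

lemma mpoly_eval_pderiv:
  "mpoly_eval (mpoly_pderiv i p) x
     = (\<Sum>m\<in>Poly_Mapping.keys p. Poly_Mapping.lookup p m *
          (real (Poly_Mapping.lookup m i) * monom_eval (m - Poly_Mapping.single i 1) x))"
  by (simp add: mpoly_pderiv_def mpoly_eval_sum mpoly_eval_single mult_ac)

lemma has_real_derivative_monom_eval:
  "((\<lambda>t. monom_eval m (x + t *\<^sub>R axis i 1)) has_real_derivative
      real (Poly_Mapping.lookup m i) * monom_eval (m - Poly_Mapping.single i 1) x) (at 0)"
proof -
  let ?P = "\<Prod>j\<in>UNIV - {i}. (x $ j) ^ Poly_Mapping.lookup m j"
  have "monom_eval m (x + t *\<^sub>R axis i 1) = (x $ i + t) ^ Poly_Mapping.lookup m i * ?P" for t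
    unfolding monom_eval_def by (subst prod.remove[of _ i]) (auto simp: axis_def)
  moreover have "monom_eval (m - Poly_Mapping.single i 1) x
      = (x $ i) ^ (Poly_Mapping.lookup m i - 1) * ?P"
    unfolding monom_eval_def
    by (subst prod.remove[of _ i]) (auto simp: lookup_minus lookup_single)
  moreover have "((\<lambda>t. (x $ i + t) ^ Poly_Mapping.lookup m i * ?P) has_real_derivative
      real (Poly_Mapping.lookup m i) * ((x $ i) ^ (Poly_Mapping.lookup m i - 1) * ?P)) (at 0)"
    by (auto intro!: derivative_eq_intros)
  ultimately show ?thesis
    by simp
qed

lemma has_real_derivative_mpoly_eval:
  "((\<lambda>t. mpoly_eval p (x + t *\<^sub>R axis i 1)) has_real_derivative
      mpoly_eval (mpoly_pderiv i p) x) (at 0)"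
  unfolding mpoly_eval_pderiv mpoly_eval_def[of p] monom_eval_def[symmetric]
  by (intro DERIV_sum DERIV_cmult has_real_derivative_monom_eval)

lemma mpoly_eval_pos:
  assumes "nonneg_coeffs p" "p \<noteq> 0" "\<And>i. x $ i > 0"
  shows "mpoly_eval p x > 0"
proof -
  have "\<exists>m. m \<in> Poly_Mapping.keys p"
    using assms(2) by (simp add: ex_in_conv)
  moreover have "Poly_Mapping.lookup p m > 0" if "m \<in> Poly_Mapping.keys p" for m
    using assms(1) that by (auto simp: nonneg_coeffs_def in_keys_iff less_le)
  ultimately show ?thesis
    unfolding mpoly_eval_def using assms(3)
    by (intro sum_pos mult_pos_pos prod_pos zero_less_power) auto
qed

section \<open>Log-concavity at the all-ones vector\<close>

definition eval_one :: "'n::finite mpoly \<Rightarrow> real" where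
  "eval_one p = mpoly_eval p (\<chi> i. 1)"

definition hess_one :: "'n::finite mpoly \<Rightarrow> real ^ 'n ^ 'n" where
  "hess_one p = (\<chi> i j. eval_one (mpoly_pderiv i (mpoly_pderiv j p)))"

definition grad_one :: "'n::finite mpoly \<Rightarrow> real ^ 'n" where
  "grad_one p = (\<chi> i. eval_one (mpoly_pderiv i p))"

lemma eval_one_0 [simp]: "eval_one 0 = 0"
  by (simp add: eval_one_def)

lemma eval_one_pos: "nonneg_coeffs p \<Longrightarrow> p \<noteq> 0 \<Longrightarrow> eval_one p > 0"
  by (simp add: eval_one_def mpoly_eval_pos)

lemma eval_one_nonneg: "nonneg_coeffs p \<Longrightarrow> eval_one p \<ge> 0"
  using eval_one_pos[of p] by (cases "p = 0") auto

text \<open>In Euler's identity each monomial is multiplied by its total degree; at the all-ones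
  vector the factors \<open>x\<^sub>i\<close> and the monomials themselves equal 1.\<close>

lemma euler_eval_one:
  assumes "homogeneous d p"
  shows "(\<Sum>i\<in>UNIV. eval_one (mpoly_pderiv i p)) = real d * eval_one p"
proof -
  have "(\<Sum>i\<in>UNIV. eval_one (mpoly_pderiv i p))
      = (\<Sum>m\<in>Poly_Mapping.keys p. Poly_Mapping.lookup p m * real (\<Sum>i\<in>UNIV. Poly_Mapping.lookup m i))"
    unfolding eval_one_def mpoly_eval_pderiv
    by (subst sum.swap) (simp add: monom_eval_def sum_distrib_left)
  also have "\<dots> = (\<Sum>m\<in>Poly_Mapping.keys p. Poly_Mapping.lookup p m * real d)"
    using assms by (intro sum.cong refl) (auto simp: homogeneous_def)
  finally show ?thesis
    by (simp add: eval_one_def mpoly_eval_def sum_distrib_left mult_ac)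
qed

lemma transpose_hess_one: "transpose (hess_one p) = hess_one p"
  by (auto simp: hess_one_def transpose_def vec_eq_iff mpoly_pderiv_commute)

lemma partial_deriv_ln_mpoly_eval:
  assumes "nonneg_coeffs p" "p \<noteq> 0" "\<And>i. x $ i > 0"
  shows "partial_deriv j (\<lambda>x. ln (mpoly_eval p x)) x
       = mpoly_eval (mpoly_pderiv j p) x / mpoly_eval p x"
  unfolding partial_deriv_def
  using mpoly_eval_pos[OF assms]
  by (intro DERIV_imp_deriv)
     (auto intro!: derivative_eq_intros has_real_derivative_mpoly_eval)

lemma hessian_ln_mpoly_eval_one:
  assumes "nonneg_coeffs p" "p \<noteq> 0"
  shows "hessian (\<lambda>x. ln (mpoly_eval p x)) (\<chi> i. 1) $ i $ j
       = hess_one p $ i $ j / eval_one p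
         - grad_one p $ i * grad_one p $ j / (eval_one p)\<^sup>2"
proof -
  let ?one = "(\<chi> i. 1) :: real ^ 'a"
  have pos: "mpoly_eval p ?one > 0"
    by (rule mpoly_eval_pos[OF assms]) simp
  \<comment> \<open>The outer derivative needs the formula for the inner one on a neighbourhood; for
    \<open>t\<close> in this interval the point stays in the positive orthant, where
    \<open>p\<close> is positive.\<close>
  have "eventually (\<lambda>t::real. t \<in> {-1<..<1}) (nhds 0)"
    by (intro eventually_nhds_in_open) auto
  then have "eventually (\<lambda>t. partial_deriv j (\<lambda>x. ln (mpoly_eval p x)) (?one + t *\<^sub>R axis i 1)
      = mpoly_eval (mpoly_pderiv j p) (?one + t *\<^sub>R axis i 1)
        / mpoly_eval p (?one + t *\<^sub>R axis i 1)) (nhds 0)"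
    by eventually_elim (auto intro!: partial_deriv_ln_mpoly_eval[OF assms] simp: axis_def)
  then have "partial_deriv i (partial_deriv j (\<lambda>x. ln (mpoly_eval p x))) ?one
      = deriv (\<lambda>t. mpoly_eval (mpoly_pderiv j p) (?one + t *\<^sub>R axis i 1)
        / mpoly_eval p (?one + t *\<^sub>R axis i 1)) 0"
    unfolding partial_deriv_def[of i] by (intro deriv_cong_ev) auto
  also have "\<dots> = (mpoly_eval (mpoly_pderiv i (mpoly_pderiv j p)) ?one * mpoly_eval p ?one
      - mpoly_eval (mpoly_pderiv j p) ?one * mpoly_eval (mpoly_pderiv i p) ?one)
        / (mpoly_eval p ?one * mpoly_eval p ?one)"
    using pos DERIV_divide[OF has_real_derivative_mpoly_eval[of "mpoly_pderiv j p" ?one i]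
        has_real_derivative_mpoly_eval[of p ?one i]]
    by (intro DERIV_imp_deriv) simp
  finally show ?thesis
    using pos by (simp add: hessian_def hess_one_def grad_one_def eval_one_def field_simps
        power2_eq_square)
qed

text \<open>The Hessian of the logarithm is \<open>H / q - g g\<^sup>T / q\<^sup>2\<close> with
  \<open>q\<close> the value and \<open>g\<close> the gradient of \<open>p\<close>; multiplying its
  form by \<open>q\<^sup>2\<close> removes the logarithm.\<close>

lemma log_concave_at_one_iff:
  assumes "nonneg_coeffs p"
  shows "log_concave_at_one p \<longleftrightarrow>
    (\<forall>v. eval_one p * (v \<bullet> (hess_one p *v v)) \<le> (v \<bullet> grad_one p)\<^sup>2)"
proof (cases "p = 0")
  case True
  then show ?thesis
    by (simp add: log_concave_at_one_def)
next
  case False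
  let ?M = "hessian (\<lambda>x. ln (mpoly_eval p x)) (\<chi> i. 1)"
  have pos: "eval_one p > 0"
    by (rule eval_one_pos[OF assms False])
  note M = hessian_ln_mpoly_eval_one[OF assms False]
  have H: "hess_one p $ i $ j = hess_one p $ j $ i" for i j
    by (simp add: hess_one_def mpoly_pderiv_commute)
  have "transpose ?M = ?M"
    by (simp add: vec_eq_iff transpose_def M H mult_ac)
  moreover have "v \<bullet> (?M *v v)
      = (eval_one p * (v \<bullet> (hess_one p *v v)) - (v \<bullet> grad_one p)\<^sup>2) / (eval_one p)\<^sup>2" for v
  proof -
    have sq: "(v \<bullet> grad_one p)\<^sup>2
        = (\<Sum>i\<in>UNIV. \<Sum>j\<in>UNIV. grad_one p $ i * grad_one p $ j * v $ i * v $ j)"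
      by (simp add: inner_vec_def power2_eq_square sum_product mult_ac)
    have "v \<bullet> (?M *v v) = (\<Sum>i\<in>UNIV. \<Sum>j\<in>UNIV. (1 / eval_one p) * (hess_one p $ i $ j * v $ i * v $ j)
        - (1 / (eval_one p)\<^sup>2) * (grad_one p $ i * grad_one p $ j * v $ i * v $ j))"
      unfolding inner_matrix_vector_sum M
      by (intro sum.cong refl) (simp add: algebra_simps)
    also have "\<dots> = (1 / eval_one p) * (v \<bullet> (hess_one p *v v))
        - (1 / (eval_one p)\<^sup>2) * (v \<bullet> grad_one p)\<^sup>2"
      by (simp only: sum_subtractf sq inner_matrix_vector_sum sum_distrib_left)
    also have "\<dots> = (eval_one p * (v \<bullet> (hess_one p *v v)) - (v \<bullet> grad_one p)\<^sup>2) / (eval_one p)\<^sup>2"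
      using pos by (simp add: field_simps power2_eq_square)
    finally show ?thesis .
  qed
  ultimately show ?thesis
    using pos False
    by (simp add: log_concave_at_one_def negative_semidefinite_def divide_le_0_iff)
qed

section \<open>Euler's identity and the hyperplane criterion for log-concavity\<close>

lemma hess_one_mult_one:
  assumes "homogeneous d p"
  shows "hess_one p *v (\<chi> i. 1) = real (d - 1) *\<^sub>R grad_one p"
proof -
  have "(\<Sum>j\<in>UNIV. eval_one (mpoly_pderiv i (mpoly_pderiv j p)))
      = real (d - 1) * eval_one (mpoly_pderiv i p)" for i
    using euler_eval_one[OF homogeneous_pderiv[OF assms, of i]]
    by (simp add: mpoly_pderiv_commute[of i])
  then show ?thesis
    by (simp add: vec_eq_iff matrix_vector_mult_def hess_one_def grad_one_def)
qed

lemma grad_one_inner_one: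
  assumes "homogeneous d p"
  shows "(\<chi> i. 1) \<bullet> grad_one p = real d * eval_one p"
  using euler_eval_one[OF assms] by (simp add: inner_vec_def grad_one_def)

text \<open>Split off the component of \<open>v\<close> along the all-ones vector, on which the form is explicit by
  Euler's identity.\<close>

lemma hess_one_bound_if_nonpos_on_hyperplane:
  assumes "nonneg_coeffs p" "homogeneous d p" "d > 0"
    and nonpos: "\<And>w. w \<bullet> grad_one p = 0 \<Longrightarrow> w \<bullet> (hess_one p *v w) \<le> 0"
  shows "real d * eval_one p * (v \<bullet> (hess_one p *v v)) \<le> real (d - 1) * (v \<bullet> grad_one p)\<^sup>2"
proof (cases "p = 0")
  case False
  let ?one = "(\<chi> i. 1) :: real ^ 'a"
  let ?H = "hess_one p"
  define q where "q = eval_one p"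
  define L where "L = v \<bullet> grad_one p"
  define c where "c = L / (real d * q)"
  have q: "q > 0"
    unfolding q_def by (rule eval_one_pos[OF assms(1) False])
  have c: "c * (real d * q) = L"
    using q assms(3) by (simp add: c_def)
  have one: "?one \<bullet> grad_one p = real d * q"
    using grad_one_inner_one[OF assms(2)] by (simp add: q_def)
  have "(v - c *\<^sub>R ?one) \<bullet> grad_one p = 0"
    by (simp add: inner_diff_left one c flip: L_def)
  then have "(v - c *\<^sub>R ?one) \<bullet> (?H *v (v - c *\<^sub>R ?one)) \<le> 0"
    by (rule nonpos)
  also have "(v - c *\<^sub>R ?one) \<bullet> (?H *v (v - c *\<^sub>R ?one))
      = v \<bullet> (?H *v v) - 2 * c * (v \<bullet> (?H *v ?one)) + c * c * (?one \<bullet> (?H *v ?one))"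
    using inner_matrix_vector_symmetric[OF transpose_hess_one, of ?one p v]
    by (simp add: matrix_vector_mult_diff_distrib matrix_vector_mult_scaleR inner_diff_left
        inner_diff_right algebra_simps)
  also have "\<dots> = v \<bullet> (?H *v v) - 2 * c * (real (d - 1) * L) + c * (real (d - 1) * (c * (real d * q)))"
    by (simp add: hess_one_mult_one[OF assms(2)] one flip: L_def)
  finally have "v \<bullet> (?H *v v) \<le> real (d - 1) * (c * L)"
    unfolding c by (simp add: mult_ac)
  then have "(real d * q) * (v \<bullet> (?H *v v)) \<le> (real d * q) * (real (d - 1) * (c * L))"
    using q by (intro mult_left_mono) auto
  also have "\<dots> = real (d - 1) * (c * (real d * q)) * L"
    by simp
  finally show ?thesis
    unfolding c by (simp add: power2_eq_square q_def L_def mult_ac)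
qed simp

lemma log_concave_at_one_if_nonpos_on_hyperplane:
  assumes "nonneg_coeffs p" "homogeneous d p" "d > 0"
    and "\<And>w. w \<bullet> grad_one p = 0 \<Longrightarrow> w \<bullet> (hess_one p *v w) \<le> 0"
  shows "log_concave_at_one p"
  unfolding log_concave_at_one_iff[OF assms(1)]
proof
  fix v
  have "real d * eval_one p * (v \<bullet> (hess_one p *v v)) \<le> real (d - 1) * (v \<bullet> grad_one p)\<^sup>2"
    by (rule hess_one_bound_if_nonpos_on_hyperplane[OF assms])
  also have "\<dots> \<le> real d * (v \<bullet> grad_one p)\<^sup>2"
    by (intro mult_right_mono) auto
  finally show "eval_one p * (v \<bullet> (hess_one p *v v)) \<le> (v \<bullet> grad_one p)\<^sup>2"
    using assms(3) by (simp add: mult.assoc)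
qed

text \<open>Combined with the bound from the hyperplane condition, this sharpens log-concavity of a
  form of degree \<open>d\<close> by the factor \<open>(d - 1) / d\<close>, which the descent from
  the partial derivatives relies on.\<close>

lemma log_concave_at_one_nonpos_on_hyperplane:
  assumes "nonneg_coeffs p" "log_concave_at_one p" "w \<bullet> grad_one p = 0"
  shows "w \<bullet> (hess_one p *v w) \<le> 0"
proof (cases "p = 0")
  case True
  then show ?thesis
    by (simp add: inner_matrix_vector_sum hess_one_def)
next
  case False
  have "eval_one p * (w \<bullet> (hess_one p *v w)) \<le> 0"
    using assms(2,3) unfolding log_concave_at_one_iff[OF assms(1)]
    by (metis power_zero_numeral)
  then show ?thesis
    using eval_one_pos[OF assms(1) False] by (simp add: mult_le_0_iff)
qed

section \<open>Indecomposability as connectedness of the Hessian\<close>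

text \<open>Nonnegative coefficients cannot cancel, so a zero Hessian entry means that no monomial
  contains both variables. Hence every monomial lives in \<open>I\<close> or in its complement, and
  \<open>i\<close> and \<open>j\<close> make both parts nonconstant.\<close>

lemma decomposable_if_hess_one_block:
  assumes nn: "nonneg_coeffs p"
    and block: "\<And>k l. k \<in> I \<Longrightarrow> l \<notin> I \<Longrightarrow> hess_one p $ k $ l = 0"
    and i: "i \<in> I" "grad_one p $ i \<noteq> 0" and j: "j \<notin> I" "grad_one p $ j \<noteq> 0"
  shows "decomposable p"
proof -
  let ?P = "\<lambda>m. Poly_Mapping.keys m \<subseteq> I"
  have apart: "Poly_Mapping.lookup m k = 0 \<or> Poly_Mapping.lookup m l = 0"
    if m: "m \<in> Poly_Mapping.keys p" and kl: "k \<in> I" "l \<notin> I" for m k l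
  proof (rule ccontr)
    assume *: "\<not> ?thesis"
    \<comment> \<open>Here \<open>k\<close> and \<open>l\<close> differ, so both can be removed from
      \<open>m\<close>, and the coefficient of \<open>m\<close> survives at \<open>m'\<close> up to
      a positive factor.\<close>
    define m' where "m' = m - Poly_Mapping.single k 1 - Poly_Mapping.single l 1"
    have "m' + Poly_Mapping.single k 1 + Poly_Mapping.single l 1 = m"
      using * kl
      by (intro poly_mapping_eqI)
         (auto simp: m'_def lookup_add lookup_minus lookup_single when_def)
    then have "Poly_Mapping.lookup (mpoly_pderiv k (mpoly_pderiv l p)) m' \<noteq> 0"
      using m by (auto simp: lookup_mpoly_pderiv in_keys_iff)
    then have "mpoly_pderiv k (mpoly_pderiv l p) \<noteq> 0"
      by auto
    then have "hess_one p $ k $ l > 0"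
      using eval_one_pos[OF nonneg_coeffs_pderiv[OF nonneg_coeffs_pderiv[OF nn]]]
      by (simp add: hess_one_def)
    with block[OF kl] show False
      by simp
  qed
  have occurs: "\<exists>m\<in>Poly_Mapping.keys p. Poly_Mapping.lookup m k \<noteq> 0"
    if nz: "grad_one p $ k \<noteq> 0" for k
  proof -
    have "mpoly_pderiv k p \<noteq> 0"
      using nz by (auto simp: grad_one_def)
    then obtain m where "Poly_Mapping.lookup (mpoly_pderiv k p) m \<noteq> 0"
      by (metis lookup_zero poly_mapping_eqI)
    then have "m + Poly_Mapping.single k 1 \<in> Poly_Mapping.keys p"
      by (auto simp: lookup_mpoly_pderiv in_keys_iff)
    then show ?thesis
      by (intro bexI) (auto simp: lookup_add)
  qed
  \<comment> \<open>A constant term, if present, goes to \<open>g\<close>, as its empty set of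
    variables lies in \<open>I\<close>.\<close>
  define g where "g = (\<Sum>m\<in>{m\<in>Poly_Mapping.keys p. ?P m}. Poly_Mapping.single m (Poly_Mapping.lookup p m))"
  define h where "h = (\<Sum>m\<in>{m\<in>Poly_Mapping.keys p. \<not> ?P m}. Poly_Mapping.single m (Poly_Mapping.lookup p m))"
  have g: "Poly_Mapping.lookup g m = (if ?P m then Poly_Mapping.lookup p m else 0)" for m
    by (auto simp: g_def lookup_sum lookup_single when_def in_keys_iff)
  have h: "Poly_Mapping.lookup h m = (if ?P m then 0 else Poly_Mapping.lookup p m)" for m
    by (auto simp: h_def lookup_sum lookup_single when_def in_keys_iff)
  have "p = g + h"
    by (intro poly_mapping_eqI) (simp add: lookup_add g h)
  moreover have "g \<in> mpolys_over I"
    by (auto simp: mpolys_over_def in_keys_iff subset_iff g split: if_splits)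
  moreover have "h \<in> mpolys_over (- I)"
  proof -
    have "Poly_Mapping.keys m \<subseteq> - I" if "m \<in> Poly_Mapping.keys h" for m
    proof -
      have m: "m \<in> Poly_Mapping.keys p" and "\<not> ?P m"
        using that by (auto simp: in_keys_iff h split: if_splits)
      then obtain l where "l \<notin> I" "Poly_Mapping.lookup m l \<noteq> 0"
        by (auto simp: in_keys_iff)
      then have "Poly_Mapping.lookup m k = 0" if "k \<in> I" for k
        using apart[OF m that, of l] by simp
      then show ?thesis
        by (auto simp: in_keys_iff)
    qed
    then show ?thesis
      by (simp add: mpolys_over_def)
  qed
  moreover have "nonconstant g"
  proof -
    obtain m where m: "m \<in> Poly_Mapping.keys p" "Poly_Mapping.lookup m i \<noteq> 0"
      using occurs[OF i(2)] by blast
    then have "?P m"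
      using apart[OF m(1) i(1)] by (auto simp: in_keys_iff)
    then have "m \<in> Poly_Mapping.keys g"
      using m(1) by (simp add: in_keys_iff g)
    moreover have "m \<noteq> 0"
      using m(2) by auto
    ultimately show ?thesis
      unfolding nonconstant_def by blast
  qed
  moreover have "nonconstant h"
  proof -
    obtain m where m: "m \<in> Poly_Mapping.keys p" "Poly_Mapping.lookup m j \<noteq> 0"
      using occurs[OF j(2)] by blast
    then have "\<not> ?P m"
      using j(1) by (auto simp: in_keys_iff subset_iff)
    then have "m \<in> Poly_Mapping.keys h"
      using m(1) by (simp add: in_keys_iff h)
    moreover have "m \<noteq> 0"
      using m(2) by auto
    ultimately show ?thesis
      unfolding nonconstant_def by blast
  qed
  moreover have "I \<noteq> {}" "I \<subset> UNIV"
    using i j by auto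
  ultimately show ?thesis
    unfolding decomposable_def by blast
qed

section \<open>Descent from the partial derivatives to the polynomial\<close>

text \<open>Entrywise this is Euler's identity for the second derivatives of \<open>p\<close>, which
  have degree \<open>d - 2\<close>, since derivatives commute.\<close>

lemma sum_hess_one_pderiv:
  assumes "homogeneous d p"
  shows "(\<Sum>i\<in>UNIV. v \<bullet> (hess_one (mpoly_pderiv i p) *v v)) = real (d - 2) * (v \<bullet> (hess_one p *v v))"
proof -
  have comm: "mpoly_pderiv j (mpoly_pderiv k (mpoly_pderiv i p))
      = mpoly_pderiv i (mpoly_pderiv j (mpoly_pderiv k p))" for i j k
    by (simp add: mpoly_pderiv_commute)
  have euler: "(\<Sum>i\<in>UNIV. eval_one (mpoly_pderiv j (mpoly_pderiv k (mpoly_pderiv i p))))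
      = real (d - 2) * eval_one (mpoly_pderiv j (mpoly_pderiv k p))" for j k
    using euler_eval_one[OF homogeneous_pderiv[OF homogeneous_pderiv[OF assms]], of j k]
    unfolding comm by (simp add: numeral_2_eq_2)
  have "(\<Sum>i\<in>UNIV. v \<bullet> (hess_one (mpoly_pderiv i p) *v v))
      = (\<Sum>j\<in>UNIV. \<Sum>k\<in>UNIV. (\<Sum>i\<in>UNIV. hess_one (mpoly_pderiv i p) $ j $ k) * v $ j * v $ k)"
    unfolding inner_matrix_vector_sum sum_distrib_right
    by (rule trans[OF sum.swap]) (intro sum.cong refl sum.swap)
  also have "\<dots> = (\<Sum>j\<in>UNIV. \<Sum>k\<in>UNIV. real (d - 2) * (hess_one p $ j $ k * v $ j * v $ k))"
    by (simp add: hess_one_def euler mult_ac)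
  finally show ?thesis
    by (simp add: inner_matrix_vector_sum sum_distrib_left)
qed

lemma log_concave_at_one_if_pderivs_log_concave:
  assumes nn: "nonneg_coeffs p" and hom: "homogeneous d p" and d: "d \<ge> 3"
    and indec: "indecomposable p"
    and lc: "\<And>i. log_concave_at_one (mpoly_pderiv i p)"
  shows "log_concave_at_one p"
proof -
  let ?H = "hess_one p"
  define D where "D i = real (d - 1) * grad_one p $ i" for i
  have D: "D i = (\<Sum>j\<in>UNIV. ?H $ i $ j)" for i
    using arg_cong[OF hess_one_mult_one[OF hom], of "\<lambda>v. v $ i"]
    by (simp add: D_def matrix_vector_mult_def)
  have D_inner: "(\<Sum>i\<in>UNIV. D i * w $ i) = real (d - 1) * (w \<bullet> grad_one p)" for w
    by (simp add: D_def inner_vec_def sum_distrib_left mult_ac)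
  have bound: "v \<bullet> (hess_one (mpoly_pderiv i p) *v v) \<le> real (d - 2) * (((?H *v v) $ i)\<^sup>2 / D i)" for v i
  proof (cases "mpoly_pderiv i p = 0")
    case True
    then show ?thesis
      by (simp add: D_def grad_one_def inner_matrix_vector_sum hess_one_def)
  next
    case False
    let ?q = "mpoly_pderiv i p"
    note nnq = nonneg_coeffs_pderiv[OF nn, of i]
    have Dq: "D i = real (d - 1) * eval_one ?q"
      by (simp add: D_def grad_one_def)
    have "v \<bullet> grad_one ?q = (?H *v v) $ i"
      by (simp add: inner_vec_def grad_one_def matrix_vector_mult_def hess_one_def
          mpoly_pderiv_commute[of i] mult_ac)
    \<comment> \<open>The sharpened bound for \<open>?q\<close> of degree \<open>d - 1\<close> has
      \<open>(d - 1) * eval_one ?q\<close> on the left, which is exactly \<open>D i\<close>, and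
      \<open>d - 2\<close> on the right.\<close>
    then have "D i * (v \<bullet> (hess_one ?q *v v)) \<le> real (d - 2) * ((?H *v v) $ i)\<^sup>2"
      using hess_one_bound_if_nonpos_on_hyperplane[OF nnq homogeneous_pderiv[OF hom] _
          log_concave_at_one_nonpos_on_hyperplane[OF nnq lc], of v] d
      by (simp add: Dq numeral_2_eq_2)
    moreover have "D i > 0"
      using eval_one_pos[OF nnq False] d by (simp add: Dq)
    ultimately show ?thesis
      by (simp add: field_simps)
  qed
  have trickle: "v \<bullet> (?H *v v) \<le> (\<Sum>i\<in>UNIV. ((?H *v v) $ i)\<^sup>2 / D i)" for v
  proof -
    have "real (d - 2) * (v \<bullet> (?H *v v)) \<le> real (d - 2) * (\<Sum>i\<in>UNIV. ((?H *v v) $ i)\<^sup>2 / D i)"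
      unfolding sum_hess_one_pderiv[OF hom, symmetric] sum_distrib_left
      by (intro sum_mono bound)
    \<comment> \<open>Cancelling \<open>d - 2\<close> is where \<open>d \<ge> 3\<close>
      enters.\<close>
    then show ?thesis
      using d by (simp add: mult_le_cancel_left_pos)
  qed
  have connected: "\<exists>k l. k \<in> I \<and> l \<notin> I \<and> ?H $ k $ l \<noteq> 0"
    if "i \<in> I" "j \<notin> I" "D i \<noteq> 0" "D j \<noteq> 0" for I i j
    using decomposable_if_hess_one_block[OF nn, of I i j] indec that by (auto simp: D_def)
  have "w \<bullet> (?H *v w) \<le> 0" if "w \<bullet> grad_one p = 0" for w
  proof (rule nonpos_on_hyperplane_if_trickle_down[OF transpose_hess_one _ D trickle connected])
    show "0 \<le> ?H $ i $ j" for i j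
      by (simp add: hess_one_def eval_one_nonneg nonneg_coeffs_pderiv nn)
    show "(\<Sum>i\<in>UNIV. D i * w $ i) = 0"
      using that by (simp add: D_inner)
  qed
  then show ?thesis
    using d by (intro log_concave_at_one_if_nonpos_on_hyperplane[OF nn hom]) auto
qed

section \<open>Low degrees and induction on the degree\<close>

lemma log_concave_at_one_if_degree_le_1:
  assumes "nonneg_coeffs p" "homogeneous d p" "d \<le> 1"
  shows "log_concave_at_one p"
proof -
  have "homogeneous 0 (mpoly_pderiv j p)" for j
    using homogeneous_pderiv[OF assms(2), of j] assms(3) by simp
  then have "hess_one p = 0"
    by (simp add: hess_one_def mpoly_pderiv_homogeneous_0 vec_eq_iff)
  then show ?thesis
    by (simp add: log_concave_at_one_iff[OF assms(1)])
qed

lemma log_concave_at_one_if_quadratic_pderivs_log_concave: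
  assumes "nonneg_coeffs p" "homogeneous (k + 2) p"
    and "\<And>is. length is \<le> k \<Longrightarrow> indecomposable (mpoly_pderivs is p)"
    and "\<And>is. length is = k \<Longrightarrow> log_concave_at_one (mpoly_pderivs is p)"
  shows "log_concave_at_one p"
  using assms
proof (induction k arbitrary: p)
  case 0
  then show ?case
    using "0.prems"(4)[of "[]"] by simp
next
  case (Suc k)
  \<comment> \<open>The last index of the list is differentiated first, so the hypotheses pass to
    \<open>mpoly_pderiv i p\<close> by appending \<open>i\<close>.\<close>
  have snoc: "mpoly_pderivs is (mpoly_pderiv i p) = mpoly_pderivs (is @ [i]) p" for "is" i
    by (simp add: mpoly_pderivs_append)
  have "log_concave_at_one (mpoly_pderiv i p)" for i
  proof (rule Suc.IH)
    show "homogeneous (k + 2) (mpoly_pderiv i p)"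
      using homogeneous_pderiv[OF Suc.prems(2)] by simp
  qed (use Suc.prems in \<open>auto simp: snoc intro: nonneg_coeffs_pderiv\<close>)
  moreover have "indecomposable p"
    using Suc.prems(3)[of "[]"] by simp
  ultimately show ?case
    using log_concave_at_one_if_pderivs_log_concave[OF Suc.prems(1,2)] by simp
qed

theorem theorem2p16:
  fixes p :: "'n::finite mpoly" and d :: nat
  assumes "homogeneous d p"
    and "nonneg_coeffs p"
    and "\<And>is :: 'n list. length is + 2 \<le> d \<Longrightarrow> indecomposable (mpoly_pderivs is p)"
    and "\<And>is :: 'n list. length is + 2 = d \<Longrightarrow>
           mpoly_pderivs is p = 0 \<or> log_concave_at_one (mpoly_pderivs is p)"
  shows "strongly_log_concave_at_one p"
  unfolding strongly_log_concave_at_one_def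
proof
  fix "is" :: "'n list"
  let ?q = "mpoly_pderivs is p"
  have nn: "nonneg_coeffs ?q" and hom: "homogeneous (d - length is) ?q"
    using assms(1,2) by (auto intro: nonneg_coeffs_pderivs homogeneous_pderivs)
  show "log_concave_at_one ?q"
  proof (cases "length is + 2 \<le> d")
    case True
    then obtain k where k: "d = length is + 2 + k"
      using le_Suc_ex by blast
    show ?thesis
    proof (rule log_concave_at_one_if_quadratic_pderivs_log_concave[OF nn])
      show "homogeneous (k + 2) ?q"
        using hom by (simp add: k add.commute)
      show "indecomposable (mpoly_pderivs js ?q)" if "length js \<le> k" for js
        using assms(3)[of "js @ is"] that by (simp add: mpoly_pderivs_append k)
      show "log_concave_at_one (mpoly_pderivs js ?q)" if "length js = k" for js
        using assms(4)[of "js @ is"] that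
        by (auto simp: mpoly_pderivs_append k log_concave_at_one_def)
    qed
  next
    \<comment> \<open>Here the truncated degree \<open>d - length is\<close> is at most 1, also when
      there are more derivatives than \<open>d\<close>.\<close>
    case False
    then show ?thesis
      by (intro log_concave_at_one_if_degree_le_1[OF nn hom]) simp
  qed
qed

end
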